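(* For every integer $k\geq 3$ and every prime $p\geq k$ there are constants $C<\infty$ and $c>0$ such that the following holds. Let $S\subseteq\mathbb{F}_p^n$ be a random set formed by selecting at most $\binom{n+k-2}{k-1}-C(\log_p n)^2 n^{k-2}$ elements of $\mathbb{F}_p^n$ independently and uniformly at random. Then with probability $1-o(1)$ (as $n\to\infty$) there is a set $A\subseteq\mathbb{F}_p^n$ with $|A|\geq c\,p^n$ that contains no proper $k$-term arithmetic progression with common difference in $S$.
   Context: A proper $k$-term arithmetic progression with common difference $y$ in $\mathbb{F}_p^n$ is a sequence $x, x+y, x+2y,\dots,x+(k-1)y$ with $x\in\mathbb{F}_p^n$ and $y\neq 0$; it has common difference in $S$ if $y\in S$. *)

theory Defs
  imports
    "HOL-Probability.Probability"
    "HOL-Probability.Product_PMF"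
    "Berlekamp_Zassenhaus.Finite_Field"
    "Jordan_Normal_Form.Matrix"
begin

text \<open>The space $F_p^n$ is rendered as \<^term>\<open>carrier_vec n\<close> over the
  prime field \<^typ>\<open>'p mod_ring\<close>, where the type class \<^class>\<open>prime_card\<close> makes
  \<open>p = CARD('p)\<close> a prime.\<close>

definition arith_prog ::
    "nat \<Rightarrow> 'p::prime_card mod_ring Matrix.vec \<Rightarrow> 'p mod_ring Matrix.vec \<Rightarrow> 'p mod_ring Matrix.vec list" where
  "arith_prog k x y = map (\<lambda>i. x + of_nat i \<cdot>\<^sub>v y) [0..<k]"

definition contains_proper_AP ::
    "nat \<Rightarrow> nat \<Rightarrow> 'p::prime_card mod_ring Matrix.vec set \<Rightarrow> 'p mod_ring Matrix.vec set \<Rightarrow> bool" where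
  "contains_proper_AP n k S A \<longleftrightarrow>
     (\<exists>x \<in> carrier_vec n. \<exists>y \<in> carrier_vec n.
        y \<noteq> 0\<^sub>v n \<and> y \<in> S \<and> set (arith_prog k x y) \<subseteq> A)"

text \<open>The \<open>m\<close> selections are made with replacement, so the resulting set may have fewer
  than \<open>m\<close> elements and may contain the zero vector. The second argument of \<^const>\<open>Pi_pmf\<close>
  is only the value taken outside the index set.\<close>

definition random_set :: "nat \<Rightarrow> nat \<Rightarrow> 'p::prime_card mod_ring Matrix.vec set pmf" where
  "random_set n m =
     map_pmf (\<lambda>s. s ` {..<m}) (Pi_pmf {..<m} (0\<^sub>v n) (\<lambda>_. pmf_of_set (carrier_vec n)))"

end

theory Submission
  imports
    Defs
    "Berlekamp_Zassenhaus.Berlekamp_Type_Based"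
    "HOL-Real_Asymp.Real_Asymp"
begin

text \<open>Put \<open>d = k - 1\<close>. A form \<open>f\<close> of degree \<open>d\<close> satisfies \<open>\<Delta>\<^sub>y\<^sup>d f(x) = d! f(y)\<close>, so if \<open>f\<close> vanishes
  nowhere on \<open>S\<close>, no level set of \<open>f\<close> contains a \<open>k\<close>-term progression with difference in \<open>S\<close>, and the
  most popular level set has density at least \<open>1/p\<close>.

  Such an \<open>f\<close> is built one random point at a time; a new point can only cause trouble if it lies in
  the common zero set \<open>Z\<close> of all forms vanishing at the previous points. If \<open>Z\<close> had at least
  \<open>p^(n'+1)\<close> elements, some linear map \<open>\<phi>\<close> into an \<open>n'\<close>-dimensional space would send \<open>Z\<close> to a set of
  density more than \<open>1 - 1/p\<close>. When there are fewer than \<open>binomial(n'+d-1, d)\<close> previous points, a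
  nonzero form \<open>q\<close> in \<open>n'\<close> variables vanishes at their images; then \<open>q \<circ> \<phi>\<close> vanishes on \<open>Z\<close>, so \<open>q\<close>
  has too many zeros. Taking \<open>n - n'\<close> a multiple of \<open>log\<^sub>p n\<close> makes the union bound over all points
  tend to zero.\<close>

no_notation Finite_Cartesian_Product.vec_nth (infixl "$" 90)

section \<open>Iterated forward differences of sequences\<close>

primrec fdiff :: "nat \<Rightarrow> (nat \<Rightarrow> 'a::comm_ring_1) \<Rightarrow> nat \<Rightarrow> 'a" where
  "fdiff 0 g = g"
| "fdiff (Suc m) g = (\<lambda>i. fdiff m g (Suc i) - fdiff m g i)"

lemma fdiff_add: "fdiff m (\<lambda>i. g i + h i) i = fdiff m g i + fdiff m h i"
  by (induction m arbitrary: i) auto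

lemma fdiff_diff: "fdiff m (\<lambda>i. g i - h i) i = fdiff m g i - fdiff m h i"
  by (induction m arbitrary: i) auto

lemma fdiff_shift: "fdiff m (\<lambda>i. g (j + i)) i = fdiff m g (j + i)"
  by (induction m arbitrary: i) auto

text \<open>An m-th difference at \<open>i\<close> involves only the values at
  \<open>i, ..., i + m\<close>.\<close>

lemma fdiff_eq_0: "(\<And>j. j \<le> m \<Longrightarrow> g (i + j) = 0) \<Longrightarrow> fdiff m g i = 0"
proof (induction m arbitrary: i)
  case 0
  show ?case using "0"[of 0] by simp
next
  case (Suc m)
  have "fdiff m g (Suc i) = 0" by (rule Suc.IH) (use Suc.prems[of "Suc _"] in simp)
  moreover have "fdiff m g i = 0" by (rule Suc.IH) (use Suc.prems in simp)
  ultimately show ?case by simp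
qed

lemma fdiff_const: "0 < m \<Longrightarrow> (\<And>j. j \<le> m \<Longrightarrow> g (i + j) = c) \<Longrightarrow> fdiff m g i = 0"
proof -
  assume m: "0 < m" and g: "\<And>j. j \<le> m \<Longrightarrow> g (i + j) = c"
  have "fdiff (Suc l) (\<lambda>_. c) i' = 0" for l i'
    by (induction l arbitrary: i') auto
  then have "fdiff m (\<lambda>_. c) i = 0"
    using m by (cases m) (simp_all del: fdiff.simps)
  moreover have "fdiff m (\<lambda>j. g j - c) i = 0"
    by (rule fdiff_eq_0) (simp add: g)
  ultimately show ?thesis by (simp add: fdiff_diff)
qed

text \<open>Leibniz rule for a factor linear in \<open>i\<close>: the second and higher differences
  of that factor vanish, so only two terms survive.\<close>

lemma fdiff_linear_mult:
  "fdiff (Suc m) (\<lambda>i. (a + of_nat i * b) * g i) i =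
    (a + of_nat i * b) * fdiff (Suc m) g i + of_nat (Suc m) * b * fdiff m g (Suc i)"
proof (induction m arbitrary: i)
  case 0
  show ?case by (simp add: algebra_simps)
next
  case (Suc m)
  have "fdiff (Suc (Suc m)) (\<lambda>i. (a + of_nat i * b) * g i) i =
      fdiff (Suc m) (\<lambda>i. (a + of_nat i * b) * g i) (Suc i) - fdiff (Suc m) (\<lambda>i. (a + of_nat i * b) * g i) i"
    by simp
  also have "\<dots> = (a + of_nat i * b) * fdiff (Suc (Suc m)) g i + of_nat (Suc (Suc m)) * b * fdiff (Suc m) g (Suc i)"
    unfolding Suc.IH by (simp add: algebra_simps)
  finally show ?case .
qed

section \<open>Forms of degree \<open>d\<close> and their closure properties\<close>

text \<open>A homogeneous polynomial \<open>f\<close> of degree \<open>d\<close> satisfies \<open>\<Delta>\<^sub>y\<^sup>d f(x) = d! f(y)\<close>. Taking this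
  identity as the definition makes closure under addition and linear substitution immediate.\<close>

definition forms :: "nat \<Rightarrow> nat \<Rightarrow> ('p::prime_card mod_ring Matrix.vec \<Rightarrow> 'p mod_ring) set" where
  "forms n d = {f \<in> carrier_vec n \<rightarrow>\<^sub>E UNIV. \<forall>x\<in>carrier_vec n. \<forall>y\<in>carrier_vec n.
     fdiff d (\<lambda>i. f (x + of_nat i \<cdot>\<^sub>v y)) 0 = of_nat (fact d) * f y}"

text \<open>Forms are extensional so that they can be counted: they live among the finitely many
  functions on a finite space.\<close>

lemma finite_forms: "finite (forms n d :: ('p::prime_card mod_ring Matrix.vec \<Rightarrow> _) set)"
  by (rule finite_subset[of _ "carrier_vec n \<rightarrow>\<^sub>E UNIV"])
     (auto simp: forms_def intro!: finite_PiE)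

text \<open>Moving the base point to \<open>x + of_nat j \<cdot>\<^sub>v y\<close> carries the
  identity from index 0 to every index: the d-th difference is constant along the line.\<close>

lemma formsD:
  assumes "f \<in> forms n d" "x \<in> carrier_vec n" "y \<in> carrier_vec n"
  shows "fdiff d (\<lambda>i. f (x + of_nat i \<cdot>\<^sub>v y)) j = of_nat (fact d) * f y"
proof -
  have eq: "x + of_nat (j + i) \<cdot>\<^sub>v y = (x + of_nat j \<cdot>\<^sub>v y) + of_nat i \<cdot>\<^sub>v y" for i
    using assms by (intro eq_vecI) (auto simp: algebra_simps)
  have "fdiff d (\<lambda>i. f (x + of_nat i \<cdot>\<^sub>v y)) (j + 0) = fdiff d (\<lambda>i. f (x + of_nat (j + i) \<cdot>\<^sub>v y)) 0"
    by (rule fdiff_shift[symmetric])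
  also have "\<dots> = of_nat (fact d) * f y"
  proof -
    have "x + of_nat j \<cdot>\<^sub>v y \<in> carrier_vec n" using assms by simp
    then show ?thesis unfolding eq using assms unfolding forms_def by blast
  qed
  finally show ?thesis by simp
qed

lemma formsI:
  assumes "\<And>x y. x \<in> carrier_vec n \<Longrightarrow> y \<in> carrier_vec n \<Longrightarrow>
    fdiff d (\<lambda>i. f (x + of_nat i \<cdot>\<^sub>v y)) 0 = of_nat (fact d) * f y"
  shows "restrict f (carrier_vec n) \<in> forms n d"
  using assms by (simp add: forms_def)

lemma forms_extensional: "f \<in> forms n d \<Longrightarrow> f \<in> extensional (carrier_vec n)"
  by (simp add: forms_def PiE_def)

lemma forms_add:
  "f \<in> forms n d \<Longrightarrow> g \<in> forms n d \<Longrightarrow> restrict (\<lambda>x. f x + g x) (carrier_vec n) \<in> forms n d"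
  by (rule formsI) (simp add: fdiff_add formsD algebra_simps)

lemma forms_diff:
  "f \<in> forms n d \<Longrightarrow> g \<in> forms n d \<Longrightarrow> restrict (\<lambda>x. f x - g x) (carrier_vec n) \<in> forms n d"
  by (rule formsI) (simp add: fdiff_diff formsD algebra_simps)

lemma forms_compose_linear:
  assumes "f \<in> forms n' d"
    and "\<And>x. x \<in> carrier_vec n \<Longrightarrow> \<phi> x \<in> carrier_vec n'"
    and "\<And>x y c. x \<in> carrier_vec n \<Longrightarrow> y \<in> carrier_vec n \<Longrightarrow> \<phi> (x + c \<cdot>\<^sub>v y) = \<phi> x + c \<cdot>\<^sub>v \<phi> y"
  shows "restrict (\<lambda>x. f (\<phi> x)) (carrier_vec n) \<in> forms n d"
  by (rule formsI) (simp add: assms(2,3) formsD[OF assms(1)])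

lemma forms_mult_coordinate:
  assumes f: "f \<in> forms n d" and j: "j < n"
  shows "restrict (\<lambda>x. x $ j * f x) (carrier_vec n) \<in> forms n (Suc d)"
proof (rule formsI)
  fix x y :: "'a mod_ring Matrix.vec"
  assume x: "x \<in> carrier_vec n" and y: "y \<in> carrier_vec n"
  have "fdiff (Suc d) (\<lambda>i. (x + of_nat i \<cdot>\<^sub>v y) $ j * f (x + of_nat i \<cdot>\<^sub>v y)) 0 =
      fdiff (Suc d) (\<lambda>i. (x $ j + of_nat i * y $ j) * f (x + of_nat i \<cdot>\<^sub>v y)) 0"
    using x y j by (simp del: fdiff.simps)
  \<comment> \<open>The first Leibniz term vanishes because the d-th difference of \<open>f\<close>
    is constant along the line; the second evaluates that difference at index 1.\<close>
  also have "\<dots> = of_nat (Suc d) * y $ j * (of_nat (fact d) * f y)"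
    unfolding fdiff_linear_mult by (simp add: formsD[OF f x y])
  also have "\<dots> = of_nat (fact (Suc d)) * (y $ j * f y)"
    by (simp add: algebra_simps)
  finally show "fdiff (Suc d) (\<lambda>i. (x + of_nat i \<cdot>\<^sub>v y) $ j * f (x + of_nat i \<cdot>\<^sub>v y)) 0 =
      of_nat (fact (Suc d)) * (y $ j * f y)" .
qed

section \<open>Forms on lines in characteristic larger than the degree\<close>

lemma of_nat_mod_ring_eq_0_iff:
  "(of_nat a :: 'p::prime_card mod_ring) = 0 \<longleftrightarrow> CARD('p) dvd a"
  by transfer (metis of_nat_dvd_iff dvd_eq_mod_eq_0)

lemma of_nat_fact_mod_ring_neq_0:
  assumes "d < CARD('p::prime_card)"
  shows "(of_nat (fact d) :: 'p mod_ring) \<noteq> 0"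
  using assms prime_dvd_fact_iff[OF prime_card[where 'a='p], of d]
  by (simp add: of_nat_mod_ring_eq_0_iff)

text \<open>If all \<open>d + 1\<close> values vanished, so would the d-th difference
  \<open>d! f(y)\<close>; but \<open>p\<close> does not divide \<open>d!\<close>.\<close>

lemma forms_nonzero_on_line:
  fixes f :: "'p::prime_card mod_ring Matrix.vec \<Rightarrow> 'p mod_ring"
  assumes "f \<in> forms n d" "d < CARD('p)" "x \<in> carrier_vec n" "y \<in> carrier_vec n" "f y \<noteq> 0"
  shows "\<exists>i\<le>d. f (x + of_nat i \<cdot>\<^sub>v y) \<noteq> 0"
proof (rule ccontr)
  assume "\<not> ?thesis"
  then have "fdiff d (\<lambda>i. f (x + of_nat i \<cdot>\<^sub>v y)) 0 = 0"
    by (intro fdiff_eq_0) auto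
  with formsD[OF assms(1,3,4), of 0] assms(5) of_nat_fact_mod_ring_neq_0[OF assms(2)]
  show False by simp
qed

text \<open>Constants are killed by differences of positive order, hence \<open>0 < d\<close>. This
  keeps progressions with \<open>d + 1\<close> terms and difference \<open>y\<close> out of the
  level sets of \<open>f\<close>.\<close>

lemma forms_not_const_on_line:
  fixes f :: "'p::prime_card mod_ring Matrix.vec \<Rightarrow> 'p mod_ring"
  assumes "f \<in> forms n d" "d < CARD('p)" "0 < d" "x \<in> carrier_vec n" "y \<in> carrier_vec n" "f y \<noteq> 0"
  shows "\<exists>i\<le>d. f (x + of_nat i \<cdot>\<^sub>v y) \<noteq> c"
proof (rule ccontr)
  assume "\<not> ?thesis"
  then have "fdiff d (\<lambda>i. f (x + of_nat i \<cdot>\<^sub>v y)) 0 = 0"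
    using assms(3) by (intro fdiff_const[where c = c]) auto
  with formsD[OF assms(1,4,5), of 0] assms(6) of_nat_fact_mod_ring_neq_0[OF assms(2)]
  show False by simp
qed

text \<open>Every point reaches a nonzero of \<open>f\<close> in at most \<open>d\<close> steps of
  \<open>y\<close>, so the \<open>d + 1\<close> translates \<open>T i\<close> of the set of nonzeros
  cover the space.\<close>

lemma card_forms_nonzero:
  fixes f :: "'p::prime_card mod_ring Matrix.vec \<Rightarrow> 'p mod_ring"
  assumes f: "f \<in> forms n d" and d: "d < CARD('p)" and y: "y \<in> carrier_vec n" "f y \<noteq> 0"
  shows "CARD('p) ^ n \<le> Suc d * card {x \<in> carrier_vec n. f x \<noteq> 0}"
proof -
  define N where "N = {x \<in> carrier_vec n. f x \<noteq> 0}"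
  have fin: "finite N" by (simp add: N_def)
  define T where "T i = (\<lambda>z. z - of_nat i \<cdot>\<^sub>v y) ` N" for i :: nat
  have "carrier_vec n \<subseteq> (\<Union>i\<le>d. T i)"
  proof
    fix x :: "'p mod_ring Matrix.vec" assume x: "x \<in> carrier_vec n"
    from forms_nonzero_on_line[OF f d x y] obtain i where i: "i \<le> d" "f (x + of_nat i \<cdot>\<^sub>v y) \<noteq> 0"
      by blast
    have "x = (x + of_nat i \<cdot>\<^sub>v y) - of_nat i \<cdot>\<^sub>v y"
      using x y by (intro eq_vecI) auto
    moreover have "x + of_nat i \<cdot>\<^sub>v y \<in> N" using x y i by (simp add: N_def)
    ultimately show "x \<in> (\<Union>i\<le>d. T i)" using i(1) unfolding T_def by blast
  qed
  then have "card (carrier_vec n :: 'p mod_ring Matrix.vec set) \<le> card (\<Union>i\<le>d. T i)"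
    by (intro card_mono) (auto simp: T_def fin)
  also have "\<dots> \<le> (\<Sum>i\<le>d. card (T i))" by (rule card_UN_le) simp
  also have "\<dots> \<le> (\<Sum>i\<le>d. card N)" by (intro sum_mono) (simp add: T_def card_image_le fin)
  finally show ?thesis by (simp add: N_def card_carrier_vec)
qed

text \<open>If \<open>f y \<noteq> 0\<close>, then \<open>y\<close> lies in the hyperplane, so the
  line through \<open>unit_vec n j\<close> in direction \<open>y\<close> stays off it; yet this line
  contains a nonzero of \<open>f\<close>.\<close>

lemma forms_eq_0_off_hyperplane:
  fixes f :: "'p::prime_card mod_ring Matrix.vec \<Rightarrow> 'p mod_ring"
  assumes f: "f \<in> forms n d" and d: "d < CARD('p)" and j: "j < n"
    and zero: "\<And>x. x \<in> carrier_vec n \<Longrightarrow> x $ j \<noteq> 0 \<Longrightarrow> f x = 0"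
    and y: "y \<in> carrier_vec n"
  shows "f y = 0"
proof (rule ccontr)
  assume fy: "f y \<noteq> 0"
  with zero y have yj: "y $ j = 0" by blast
  have "unit_vec n j \<in> carrier_vec n" by simp
  from forms_nonzero_on_line[OF f d this y fy] obtain i where
    "f (unit_vec n j + of_nat i \<cdot>\<^sub>v y) \<noteq> 0" by blast
  moreover have "(unit_vec n j + of_nat i \<cdot>\<^sub>v y) $ j = 1" using y j yj by simp
  ultimately show False using zero[of "unit_vec n j + of_nat i \<cdot>\<^sub>v y"] y by simp
qed

section \<open>A lower bound for the number of forms\<close>

text \<open>The map \<open>(f, g) \<mapsto> f(x\<^sub>0, \<dots>, x\<^sub>n\<^sub>-\<^sub>1) + x\<^sub>n g(x)\<close> turns Pascal's rule into an induction.\<close>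

lemma card_forms_ge:
  assumes "d < CARD('p::prime_card)"
  shows "CARD('p) ^ ((n + d - 1) choose d)
    \<le> card (forms n d :: ('p mod_ring Matrix.vec \<Rightarrow> 'p mod_ring) set)"
  using assms
proof (induction d arbitrary: n)
  case 0
  let ?F = "forms n 0 :: ('p mod_ring Matrix.vec \<Rightarrow> 'p mod_ring) set"
  let ?c = "\<lambda>c. restrict (\<lambda>_. c) (carrier_vec n) :: 'p mod_ring Matrix.vec \<Rightarrow> 'p mod_ring"
  have "inj ?c"
    by (intro injI) (metis restrict_apply' zero_carrier_vec)
  moreover have "range ?c \<subseteq> ?F" by (auto intro!: formsI)
  ultimately have "CARD('p mod_ring) \<le> card ?F"
    using card_inj_on_le[of ?c UNIV ?F] finite_forms by blast
  then show ?case by simp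
next
  case (Suc d)
  note IHd = Suc.IH
  have d: "Suc d < CARD('p)" "d < CARD('p)" using Suc.prems by auto
  show ?case
  proof (induction n)
    case 0
    \<comment> \<open>The exponent is \<open>d choose Suc d = 0\<close>, so the zero form alone
      suffices.\<close>
    have "restrict (\<lambda>_. 0) (carrier_vec 0) \<in> (forms 0 (Suc d) :: ('p mod_ring Matrix.vec \<Rightarrow> 'p mod_ring) set)"
      by (rule formsI) (simp add: fdiff_eq_0 del: fdiff.simps)
    then have "card (forms 0 (Suc d) :: ('p mod_ring Matrix.vec \<Rightarrow> 'p mod_ring) set) > 0"
      using finite_forms by (auto simp: card_gt_0_iff)
    then show ?case by (simp add: binomial_eq_0)
  next
    case (Suc n)
    let ?A = "forms n (Suc d) :: ('p mod_ring Matrix.vec \<Rightarrow> 'p mod_ring) set"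
    let ?B = "forms (Suc n) d :: ('p mod_ring Matrix.vec \<Rightarrow> 'p mod_ring) set"
    let ?C = "forms (Suc n) (Suc d) :: ('p mod_ring Matrix.vec \<Rightarrow> 'p mod_ring) set"
    let ?V = "carrier_vec (Suc n) :: 'p mod_ring Matrix.vec set"
    define pr where "pr x = Matrix.vec n (\<lambda>i. x $ i)" for x :: "'p mod_ring Matrix.vec"
    have pr: "pr x \<in> carrier_vec n" for x by (simp add: pr_def)
    have pr_lin: "pr (x + c \<cdot>\<^sub>v y) = pr x + c \<cdot>\<^sub>v pr y" if "x \<in> ?V" "y \<in> ?V" for x y c
      using that by (intro eq_vecI) (auto simp: pr_def)
    define E where "E = (\<lambda>(f, g). restrict (\<lambda>x. f (pr x) + x $ n * g x) ?V ::
      'p mod_ring Matrix.vec \<Rightarrow> 'p mod_ring)"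
    have "E (f, g) \<in> ?C" if f: "f \<in> ?A" and g: "g \<in> ?B" for f g
    proof -
      have "restrict (\<lambda>x. restrict (\<lambda>x. f (pr x)) ?V x + restrict (\<lambda>x. x $ n * g x) ?V x) ?V \<in> ?C"
        by (intro forms_add forms_mult_coordinate forms_compose_linear[OF f] g pr pr_lin) auto
      moreover have "restrict (\<lambda>x. restrict (\<lambda>x. f (pr x)) ?V x + restrict (\<lambda>x. x $ n * g x) ?V x) ?V = E (f, g)"
        by (auto simp: E_def fun_eq_iff)
      ultimately show ?thesis by simp
    qed
    then have im: "E ` (?A \<times> ?B) \<subseteq> ?C" by auto
    have inj: "inj_on E (?A \<times> ?B)"
    proof (rule inj_onI, clarify)
      fix f g f' g'
      assume f: "f \<in> ?A" "f' \<in> ?A" and g: "g \<in> ?B" "g' \<in> ?B" and "E (f, g) = E (f', g')"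
      then have eq: "f (pr x) + x $ n * g x = f' (pr x) + x $ n * g' x" if "x \<in> ?V" for x
        using that by (auto simp: E_def fun_eq_iff) metis
      \<comment> \<open>Points with last coordinate 0 isolate the first summand.\<close>
      have ff: "f = f'"
      proof (rule extensionalityI[OF forms_extensional forms_extensional])
        fix z :: "'p mod_ring Matrix.vec" assume z: "z \<in> carrier_vec n"
        define x where "x = Matrix.vec (Suc n) (\<lambda>i. if i < n then z $ i else 0)"
        have "pr x = z" using z by (intro eq_vecI) (auto simp: x_def pr_def)
        with eq[of x] show "f z = f' z" by (simp add: x_def)
      qed (use f in auto)
      \<comment> \<open>Where \<open>x $ n \<noteq> 0\<close> this factor cancels, so
        \<open>g - g'\<close> vanishes off a hyperplane and hence everywhere.\<close>
      have "restrict (\<lambda>x. g x - g' x) ?V y = 0" if y: "y \<in> ?V" for y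
      proof (rule forms_eq_0_off_hyperplane[OF forms_diff[OF g] d(2) _ _ y, of n])
        fix x assume "x \<in> ?V" "x $ n \<noteq> 0"
        with eq[of x] ff show "restrict (\<lambda>x. g x - g' x) ?V x = 0" by simp
      qed simp
      then have "g = g'"
        by (intro extensionalityI[OF forms_extensional forms_extensional, OF g]) auto
      with ff show "f = f' \<and> g = g'" by simp
    qed
    have "CARD('p) ^ ((Suc n + Suc d - 1) choose Suc d)
        = CARD('p) ^ ((n + Suc d - 1) choose Suc d) * CARD('p) ^ ((Suc n + d - 1) choose d)"
      by (simp flip: power_add add: add.commute)
    also have "\<dots> \<le> card ?A * card ?B"
      by (intro mult_mono Suc.IH IHd d) auto
    also have "\<dots> = card (?A \<times> ?B)" by (simp add: card_cartesian_product)
    also have "\<dots> \<le> card ?C" by (rule card_inj_on_le[OF inj im finite_forms])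
    finally show ?case .
  qed
qed

section \<open>Random linear maps and the size of an image\<close>

lemma card_orthogonal:
  fixes w :: "'p::prime_card mod_ring Matrix.vec"
  assumes w: "w \<in> carrier_vec n" "w \<noteq> 0\<^sub>v n"
  shows "CARD('p) * card {u \<in> carrier_vec n. u \<bullet> w = 0} = CARD('p) ^ n"
proof -
  obtain i where i: "i < n" "w $ i \<noteq> 0"
    using w by (metis carrier_vecD eq_vecI index_zero_vec(1) index_zero_vec(2))
  let ?V = "carrier_vec n :: 'p mod_ring Matrix.vec set"
  define L where "L t = {u \<in> ?V. u \<bullet> w = t}" for t
  \<comment> \<open>The level sets of \<open>u \<bullet> w\<close> are translates of one another, so
    all \<open>p\<close> of them have the same size.\<close>
  have "card (L t) = card (L 0)" for t
  proof (rule bij_betw_same_card)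
    let ?e = "(t / w $ i) \<cdot>\<^sub>v unit_vec n i"
    have e: "?e \<bullet> w = t" using w i by simp
    show "bij_betw (\<lambda>u. u - ?e) (L t) (L 0)"
    proof (rule bij_betw_byWitness[where f' = "\<lambda>u. u + ?e"])
      show "\<forall>a\<in>L t. a - ?e + ?e = a" by (auto simp: L_def)
      show "\<forall>a\<in>L 0. a + ?e - ?e = a" by (auto simp: L_def)
      show "(\<lambda>u. u - ?e) ` L t \<subseteq> L 0"
        using w e by (auto simp: L_def minus_scalar_prod_distrib[where n = n])
      show "(\<lambda>u. u + ?e) ` L 0 \<subseteq> L t"
        using w e by (auto simp: L_def add_scalar_prod_distrib[where n = n])
    qed
  qed
  then have "(\<Sum>t\<in>UNIV. card (L t)) = (\<Sum>t\<in>(UNIV :: 'p mod_ring set). card (L 0))"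
    by (intro sum.cong refl)
  moreover have "card ?V = (\<Sum>t\<in>UNIV. card (L t))"
    using sum.group[of ?V "UNIV :: 'p mod_ring set" "\<lambda>u. u \<bullet> w" "\<lambda>_. 1 :: nat"]
    by (simp add: L_def)
  ultimately show ?thesis by (simp add: card_carrier_vec L_def)
qed

text \<open>Cauchy-Schwarz for the fibre sizes; the sum on the right counts the colliding ordered
  pairs.\<close>

lemma card_image_ge_collisions:
  assumes "finite Z"
  shows "(real (card Z))\<^sup>2 \<le> real (card (f ` Z)) * (\<Sum>z\<in>Z. real (card {z' \<in> Z. f z' = f z}))"
proof -
  define c where "c y = real (card {z \<in> Z. f z = y})" for y
  have "real (card Z) = (\<Sum>y\<in>f ` Z. c y)"
    using sum.image_gen[OF assms, of "\<lambda>_. 1 :: real" f] by (simp add: c_def)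
  moreover have "(\<Sum>y\<in>f ` Z. c y)\<^sup>2 \<le> (\<Sum>y\<in>f ` Z. (c y)\<^sup>2) * card (f ` Z)"
    by (rule sum_squared_le_sum_of_squares)
  moreover have "(\<Sum>z\<in>Z. c (f z)) = (\<Sum>y\<in>f ` Z. (c y)\<^sup>2)"
  proof -
    have "(\<Sum>z\<in>Z. c (f z)) = (\<Sum>y\<in>f ` Z. \<Sum>z\<in>{z \<in> Z. f z = y}. c (f z))"
      by (rule sum.image_gen[OF assms])
    also have "\<dots> = (\<Sum>y\<in>f ` Z. \<Sum>z\<in>{z \<in> Z. f z = y}. c y)"
      by (intro sum.cong) auto
    also have "\<dots> = (\<Sum>y\<in>f ` Z. (c y)\<^sup>2)"
      by (simp add: c_def power2_eq_square)
    finally show ?thesis .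
  qed
  ultimately show ?thesis by (simp add: c_def mult.commute)
qed

text \<open>A uniformly random linear map identifies two given distinct points with probability
  \<open>1/p^n'\<close>, so by the second moment method some linear map sends \<open>Z\<close> onto more than a
  \<open>1 - 1/p\<close> fraction of the target.\<close>

lemma ex_linear_map_large_image:
  fixes Z :: "'p::prime_card mod_ring Matrix.vec set"
  assumes Z: "Z \<subseteq> carrier_vec n" and card_Z: "CARD('p) ^ Suc n' \<le> card Z"
  obtains \<phi> :: "'p mod_ring Matrix.vec \<Rightarrow> 'p mod_ring Matrix.vec" where
    "\<And>x. \<phi> x \<in> carrier_vec n'"
    "\<And>x y c. x \<in> carrier_vec n \<Longrightarrow> y \<in> carrier_vec n \<Longrightarrow> \<phi> (x + c \<cdot>\<^sub>v y) = \<phi> x + c \<cdot>\<^sub>v \<phi> y"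
    "CARD('p) ^ n' * (CARD('p) - 1) < CARD('p) * card (\<phi> ` Z)"
proof -
  let ?V = "carrier_vec n :: 'p mod_ring Matrix.vec set"
  define p where "p = real CARD('p)"
  have p: "p > 1" using prime_card[where 'a='p] by (simp add: p_def prime_gt_Suc_0_nat)
  \<comment> \<open>An element of \<open>\<Phi>\<close> is a matrix given by its \<open>n'\<close>
    rows, and \<open>\<phi> R\<close> multiplies by that matrix. Probabilities appear as counts over
    \<open>\<Phi>\<close>.\<close>
  define \<Phi> where "\<Phi> = ({..<n'} \<rightarrow>\<^sub>E ?V)"
  define \<phi> where "\<phi> R x = Matrix.vec n' (\<lambda>i. R i \<bullet> x)" for R and x :: "'p mod_ring Matrix.vec"
  define N M where "N = p ^ n'" and "M = real (card Z)"
  have fin: "finite Z" "finite \<Phi>"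
    using finite_subset[OF Z] by (auto simp: \<Phi>_def intro!: finite_PiE)
  have ne: "\<Phi> \<noteq> {}" unfolding \<Phi>_def by (metis PiE_eq_empty_iff emptyE zero_carrier_vec)
  have N: "N > 0" using p by (simp add: N_def)
  have "real (CARD('p) ^ Suc n') \<le> M" using card_Z unfolding M_def by (rule of_nat_mono)
  then have MN: "p * N \<le> M" by (simp add: N_def p_def)
  with N p have M: "M > 0" by (smt (verit) mult_pos_pos)
  \<comment> \<open>A collision means that all \<open>n'\<close> rows are orthogonal to
    \<open>z' - z\<close>, and a share \<open>1 / p\<close> of all vectors is.\<close>
  have coll: "real (card {R \<in> \<Phi>. \<phi> R z' = \<phi> R z}) = card \<Phi> / N"
    if z: "z \<in> Z" "z' \<in> Z" "z \<noteq> z'" for z z'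
  proof -
    define K where "K = {u \<in> ?V. u \<bullet> (z' - z) = 0}"
    have zV: "z \<in> ?V" "z' \<in> ?V" using z Z by auto
    have "z' - z \<noteq> 0\<^sub>v n"
    proof
      assume *: "z' - z = 0\<^sub>v n"
      have "z' = (z' - z) + z" using zV by (intro eq_vecI) auto
      also have "\<dots> = z" unfolding * using zV by simp
      finally show False using z by simp
    qed
    then have "CARD('p) * card K = CARD('p) ^ n"
      unfolding K_def using zV by (intro card_orthogonal) auto
    then have pK: "p * real (card K) = p ^ n"
      unfolding p_def by (metis of_nat_mult of_nat_power)
    have "\<phi> R z' = \<phi> R z \<longleftrightarrow> (\<forall>i<n'. R i \<in> K)" if "R \<in> \<Phi>" for R
    proof -
      have R: "R i \<in> ?V" if "i < n'" for i using that \<open>R \<in> \<Phi>\<close> by (auto simp: \<Phi>_def)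
      have "\<phi> R z' = \<phi> R z \<longleftrightarrow> (\<forall>i<n'. R i \<bullet> z' = R i \<bullet> z)"
        by (auto simp: \<phi>_def vec_eq_iff)
      also have "\<dots> \<longleftrightarrow> (\<forall>i<n'. R i \<in> K)"
        using R zV by (auto simp: K_def scalar_prod_minus_distrib[where n = n])
      finally show ?thesis .
    qed
    then have "{R \<in> \<Phi>. \<phi> R z' = \<phi> R z} = {R \<in> \<Phi>. \<forall>i<n'. R i \<in> K}" by blast
    also have "\<dots> = {..<n'} \<rightarrow>\<^sub>E K"
      by (simp add: \<Phi>_def K_def PiE_iff set_eq_iff) blast
    finally have "{R \<in> \<Phi>. \<phi> R z' = \<phi> R z} = {..<n'} \<rightarrow>\<^sub>E K" .
    then have "card {R \<in> \<Phi>. \<phi> R z' = \<phi> R z} = card K ^ n'"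
      by (simp add: card_PiE)
    moreover have "card \<Phi> = (CARD('p) ^ n) ^ n'"
      by (simp add: \<Phi>_def card_PiE card_carrier_vec)
    then have "real (card \<Phi>) = (p ^ n) ^ n'" by (simp add: p_def)
    then have "real (card \<Phi>) = real (card K) ^ n' * N"
      unfolding pK[symmetric] N_def by (simp add: power_mult_distrib mult.commute)
    ultimately show ?thesis using N by simp
  qed
  \<comment> \<open>Diagonal pairs always collide and contribute \<open>M\<close>; each of the at
    most \<open>M\<^sup>2\<close> other pairs collides for a share \<open>1 / N\<close> of the
    maps.\<close>
  have total: "(\<Sum>R\<in>\<Phi>. \<Sum>z\<in>Z. real (card {z' \<in> Z. \<phi> R z' = \<phi> R z})) \<le> card \<Phi> * (M + M\<^sup>2 / N)"
  proof -
    have "(\<Sum>R\<in>\<Phi>. \<Sum>z\<in>Z. real (card {z' \<in> Z. \<phi> R z' = \<phi> R z})) =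
        (\<Sum>R\<in>\<Phi>. \<Sum>z\<in>Z. \<Sum>z'\<in>Z. of_bool (\<phi> R z' = \<phi> R z))"
      using fin by (simp add: sum_of_bool_eq Int_def)
    also have "\<dots> = (\<Sum>z\<in>Z. \<Sum>R\<in>\<Phi>. \<Sum>z'\<in>Z. of_bool (\<phi> R z' = \<phi> R z))"
      by (rule sum.swap)
    also have "\<dots> = (\<Sum>z\<in>Z. \<Sum>z'\<in>Z. \<Sum>R\<in>\<Phi>. of_bool (\<phi> R z' = \<phi> R z))"
      by (intro sum.cong refl sum.swap)
    also have "\<dots> = (\<Sum>z\<in>Z. \<Sum>z'\<in>Z. real (card {R \<in> \<Phi>. \<phi> R z' = \<phi> R z}))"
      using fin by (simp add: sum_of_bool_eq Int_def)
    also have "\<dots> \<le> (\<Sum>z\<in>Z. \<Sum>z'\<in>Z. (if z' = z then real (card \<Phi>) else 0) + card \<Phi> / N)"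
    proof (intro sum_mono)
      fix z z' assume "z \<in> Z" "z' \<in> Z"
      then show "real (card {R \<in> \<Phi>. \<phi> R z' = \<phi> R z})
          \<le> (if z' = z then real (card \<Phi>) else 0) + card \<Phi> / N"
        using coll[of z z'] N by (cases "z' = z") auto
    qed
    also have "\<dots> = card \<Phi> * (M + M\<^sup>2 / N)"
      using fin by (simp add: sum.distrib M_def power2_eq_square algebra_simps)
    finally show ?thesis .
  qed
  have "\<exists>R\<in>\<Phi>. (\<Sum>z\<in>Z. real (card {z' \<in> Z. \<phi> R z' = \<phi> R z})) \<le> M + M\<^sup>2 / N"
  proof (rule ccontr)
    assume "\<not> ?thesis"
    then have "(\<Sum>R\<in>\<Phi>. M + M\<^sup>2 / N) < (\<Sum>R\<in>\<Phi>. \<Sum>z\<in>Z. real (card {z' \<in> Z. \<phi> R z' = \<phi> R z}))"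
      by (intro sum_strict_mono fin ne) auto
    with total show False by simp
  qed
  then obtain R where R: "R \<in> \<Phi>"
    "(\<Sum>z\<in>Z. real (card {z' \<in> Z. \<phi> R z' = \<phi> R z})) \<le> M + M\<^sup>2 / N" by blast
  define I where "I = real (card (\<phi> R ` Z))"
  have "M\<^sup>2 \<le> I * (\<Sum>z\<in>Z. real (card {z' \<in> Z. \<phi> R z' = \<phi> R z}))"
    unfolding M_def I_def by (rule card_image_ge_collisions[OF fin(1)])
  also have "\<dots> \<le> I * (M + M\<^sup>2 / N)"
    by (intro mult_left_mono R) (simp add: I_def)
  also have "\<dots> = M * (I * (N + M) / N)"
    using N by (simp add: add_divide_distrib distrib_left power2_eq_square mult.left_commute)
  finally have "M \<le> I * (N + M) / N"
    using M by (simp only: power2_eq_square mult_le_cancel_left_pos)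
  then have 1: "M * N \<le> I * (N + M)" using N by (simp add: pos_le_divide_eq)
  \<comment> \<open>The image has density \<open>I / N\<close>, which is at least
    \<open>M / (N + M)\<close>. As \<open>M \<ge> p * N\<close>, this is at least
    \<open>p / (p + 1)\<close>, which exceeds \<open>1 - 1 / p\<close>.\<close>
  have "N * (p - 1) < p * I"
  proof (rule ccontr)
    assume "\<not> ?thesis"
    then have "p * I \<le> N * (p - 1)" by simp
    then have "p * I * (N + M) \<le> N * (p - 1) * (N + M)"
      using N M by (intro mult_right_mono) auto
    moreover have "p * (M * N) \<le> p * (I * (N + M))" using 1 p by simp
    ultimately have "N * (p * M) \<le> N * ((p - 1) * (N + M))" by (simp add: algebra_simps)
    then have "p * M \<le> (p - 1) * (N + M)" using N by simp
    then have "M \<le> p * N - N" by (simp add: algebra_simps)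
    with MN N show False by simp
  qed
  moreover have "N * (p - 1) = real (CARD('p) ^ n' * (CARD('p) - 1))"
    using p by (simp add: N_def p_def of_nat_diff)
  moreover have "p * I = real (CARD('p) * card (\<phi> R ` Z))" by (simp add: p_def I_def)
  ultimately have "CARD('p) ^ n' * (CARD('p) - 1) < CARD('p) * card (\<phi> R ` Z)"
    by (metis of_nat_less_iff)
  moreover have "\<phi> R (x + c \<cdot>\<^sub>v y) = \<phi> R x + c \<cdot>\<^sub>v \<phi> R y" if "x \<in> ?V" "y \<in> ?V" for x y c
  proof (intro eq_vecI)
    fix i assume "i < dim_vec (\<phi> R x + c \<cdot>\<^sub>v \<phi> R y)"
    then have i: "i < n'" by (simp add: \<phi>_def)
    then have "R i \<in> ?V" using R by (auto simp: \<Phi>_def)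
    then show "\<phi> R (x + c \<cdot>\<^sub>v y) $ i = (\<phi> R x + c \<cdot>\<^sub>v \<phi> R y) $ i"
      using i that by (simp add: \<phi>_def scalar_prod_add_distrib[where n = n])
  qed (simp add: \<phi>_def)
  ultimately show ?thesis by (intro that[of "\<phi> R"]) (auto simp: \<phi>_def)
qed

section \<open>Zeros forced by vanishing on a given set\<close>

definition forced_zeros :: "nat \<Rightarrow> nat \<Rightarrow> 'p::prime_card mod_ring Matrix.vec set \<Rightarrow> 'p mod_ring Matrix.vec set" where
  "forced_zeros n d S = {v \<in> carrier_vec n. \<forall>f\<in>forms n d. (\<forall>s\<in>S. f s = 0) \<longrightarrow> f v = 0}"

text \<open>Pigeonhole: there are more forms than functions on \<open>S\<close>, so two forms agree
  on \<open>S\<close> and their difference vanishes there.\<close>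

lemma ex_form_vanishing:
  fixes S :: "'p::prime_card mod_ring Matrix.vec set"
  assumes d: "d < CARD('p)" and S: "finite S" "S \<subseteq> carrier_vec n"
    and card_S: "card S < (n + d - 1) choose d"
  obtains f y where "f \<in> forms n d" "\<And>s. s \<in> S \<Longrightarrow> f s = 0" "y \<in> carrier_vec n" "f y \<noteq> 0"
proof -
  let ?F = "forms n d :: ('p mod_ring Matrix.vec \<Rightarrow> 'p mod_ring) set"
  let ?r = "\<lambda>f :: 'p mod_ring Matrix.vec \<Rightarrow> 'p mod_ring. restrict f S"
  let ?T = "S \<rightarrow>\<^sub>E (UNIV :: 'p mod_ring set)"
  have "card (?r ` ?F) \<le> card ?T"
    by (intro card_mono finite_PiE S) auto
  also have "\<dots> = CARD('p) ^ card S" by (simp add: card_PiE S)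
  also have "\<dots> < CARD('p) ^ ((n + d - 1) choose d)"
    using card_S prime_card[where 'a='p] by (intro power_strict_increasing) (auto simp: prime_gt_Suc_0_nat)
  also have "\<dots> \<le> card ?F" by (rule card_forms_ge[OF d])
  finally have "\<not> inj_on ?r ?F" using card_image[of ?r ?F] by auto
  then obtain f g where fg: "f \<in> ?F" "g \<in> ?F" "f \<noteq> g" "?r f = ?r g" by (auto simp: inj_on_def)
  then obtain y where y: "y \<in> carrier_vec n" "f y \<noteq> g y"
    using extensionalityI[OF forms_extensional forms_extensional] by blast
  have "f s = g s" if "s \<in> S" for s using fg(4) that by (metis restrict_apply')
  then show ?thesis
    using S y by (intro that[OF forms_diff[OF fg(1,2)], of y]) auto
qed

lemma card_forced_zeros:
  fixes S :: "'p::prime_card mod_ring Matrix.vec set"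
  assumes d: "d < CARD('p)" and S: "finite S" "S \<subseteq> carrier_vec n"
    and card_S: "card S < (n' + d - 1) choose d"
  shows "card (forced_zeros n d S) < CARD('p) ^ Suc n'"
proof (rule ccontr)
  let ?Z = "forced_zeros n d S"
  assume "\<not> ?thesis"
  then have "CARD('p) ^ Suc n' \<le> card ?Z" by simp
  moreover have Z: "?Z \<subseteq> carrier_vec n" by (auto simp: forced_zeros_def)
  ultimately obtain \<phi> :: "'p mod_ring Matrix.vec \<Rightarrow> 'p mod_ring Matrix.vec" where
    \<phi>: "\<And>x. \<phi> x \<in> carrier_vec n'"
       "\<And>x y c. x \<in> carrier_vec n \<Longrightarrow> y \<in> carrier_vec n \<Longrightarrow> \<phi> (x + c \<cdot>\<^sub>v y) = \<phi> x + c \<cdot>\<^sub>v \<phi> y"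
    and large: "CARD('p) ^ n' * (CARD('p) - 1) < CARD('p) * card (\<phi> ` ?Z)"
    using ex_linear_map_large_image by blast
  have "card (\<phi> ` S) < (n' + d - 1) choose d"
    using card_S card_image_le[OF S(1), of \<phi>] by simp
  then obtain f y where f: "f \<in> forms n' d" "\<And>s. s \<in> \<phi> ` S \<Longrightarrow> f s = 0"
    and y: "y \<in> carrier_vec n'" "f y \<noteq> 0"
    using ex_form_vanishing[of d "\<phi> ` S" n'] d S \<phi>(1) by blast
  let ?g = "restrict (\<lambda>x. f (\<phi> x)) (carrier_vec n)"
  have "?g \<in> forms n d" using forms_compose_linear[OF f(1) \<phi>] .
  moreover have "?g s = 0" if "s \<in> S" for s using that S f(2) by auto
  ultimately have "?g z = 0" if "z \<in> ?Z" for z using that unfolding forced_zeros_def by blast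
  then have zero: "f x = 0" if "x \<in> \<phi> ` ?Z" for x using that Z by fastforce
  \<comment> \<open>The nonzeros of \<open>f\<close> fill at least
    \<open>1 / (d + 1) \<ge> 1 / p\<close> of the target and the image of \<open>?Z\<close> more
    than \<open>1 - 1 / p\<close>. Being disjoint, they do not both fit.\<close>
  define P where "P = {x \<in> carrier_vec n'. f x \<noteq> 0}"
  have fin: "finite P" "finite (\<phi> ` ?Z)"
    using finite_subset[OF Z] by (auto simp: P_def)
  have "card (P \<union> \<phi> ` ?Z) = card P + card (\<phi> ` ?Z)"
    using fin zero by (intro card_Un_disjoint) (auto simp: P_def)
  moreover have "card (P \<union> \<phi> ` ?Z) \<le> card (carrier_vec n' :: 'p mod_ring Matrix.vec set)"
    using \<phi>(1) by (intro card_mono) (auto simp: P_def)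
  ultimately have le: "card P + card (\<phi> ` ?Z) \<le> CARD('p) ^ n'"
    by (simp add: card_carrier_vec)
  have "CARD('p) ^ n' \<le> Suc d * card P"
    unfolding P_def by (rule card_forms_nonzero[OF f(1) d y])
  also have "\<dots> \<le> CARD('p) * card P" using d by (intro mult_right_mono) auto
  finally have "CARD('p) ^ n' + CARD('p) ^ n' * (CARD('p) - 1) < CARD('p) * (card P + card (\<phi> ` ?Z))"
    using large by (simp add: distrib_left)
  also have "\<dots> \<le> CARD('p) * CARD('p) ^ n'" using le by simp
  also have "\<dots> = CARD('p) ^ n' + CARD('p) ^ n' * (CARD('p) - 1)"
  proof -
    obtain q where "CARD('p) = Suc q" using d by (metis not0_implies_Suc not_less_zero)
    then show ?thesis by simp
  qed
  finally show False by simp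
qed

section \<open>A nonvanishing form, one random point at a time\<close>

lemma ex_nonvanishing_form_insert:
  assumes S: "S \<subseteq> carrier_vec n" and f: "f \<in> forms n d" "\<forall>s\<in>S. f s \<noteq> 0"
    and v: "v \<in> carrier_vec n" "v \<notin> forced_zeros n d S"
  shows "\<exists>f\<in>forms n d. \<forall>s\<in>insert v S. f s \<noteq> 0"
proof (cases "f v = 0")
  case True
  \<comment> \<open>Adding \<open>g\<close> repairs the value at \<open>v\<close> and leaves the
    values on \<open>S\<close> unchanged.\<close>
  from v obtain g where g: "g \<in> forms n d" "\<forall>s\<in>S. g s = 0" "g v \<noteq> 0"
    by (auto simp: forced_zeros_def)
  show ?thesis
    using S f g v True by (intro bexI[OF _ forms_add[OF f(1) g(1)]]) auto
qed (use f in auto)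

text \<open>Union bound for a two-stage experiment, with \<open>B\<close> as the failure of the
  first stage.\<close>

lemma prob_bind_pmf_le:
  assumes "\<And>q. q \<in> set_pmf Q \<Longrightarrow> q \<notin> B \<Longrightarrow> measure_pmf.prob (K q) X \<le> \<epsilon>" and "0 \<le> \<epsilon>"
  shows "measure_pmf.prob (bind_pmf Q K) X \<le> measure_pmf.prob Q B + \<epsilon>"
proof -
  have "emeasure (bind_pmf Q K) X = (\<integral>\<^sup>+q. emeasure (K q) X \<partial>Q)" by simp
  also have "\<dots> \<le> (\<integral>\<^sup>+q. indicator B q + ennreal \<epsilon> \<partial>Q)"
  proof (intro nn_integral_mono_AE AE_pmfI)
    fix q assume q: "q \<in> set_pmf Q"
    show "emeasure (K q) X \<le> indicator B q + ennreal \<epsilon>"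
    proof (cases "q \<in> B")
      case True
      then show ?thesis using measure_pmf.emeasure_le_1[of "K q" X] by (simp add: add_increasing2)
    next
      case False
      then show ?thesis using assms q by (simp add: measure_pmf.emeasure_eq_measure ennreal_leI)
    qed
  qed
  also have "\<dots> = ennreal (measure_pmf.prob Q B + \<epsilon>)"
    using assms(2) by (simp add: nn_integral_add measure_pmf.emeasure_eq_measure)
  finally show ?thesis
    using assms(2) by (simp add: measure_pmf.emeasure_eq_measure del: ennreal_plus)
qed

text \<open>With \<open>n' = n - Suc l\<close>, each draw is a forced zero with probability at most
  \<open>p^(n' + 1) / p^n = 1 / p^l\<close>; these bounds add up over the \<open>m\<close>
  draws.\<close>

lemma prob_no_nonvanishing_form:
  assumes d: "0 < d" "d < CARD('p::prime_card)"
    and m: "m \<le> ((n - Suc l) + d - 1) choose d"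
  shows "measure_pmf.prob
      (Pi_pmf {..<m} (0\<^sub>v n) (\<lambda>_. pmf_of_set (carrier_vec n :: 'p mod_ring Matrix.vec set)))
      {s. \<not> (\<exists>f\<in>forms n d. \<forall>v\<in>s ` {..<m}. f v \<noteq> 0)} \<le> m / real CARD('p) ^ l"
  using m
proof (induction m)
  case 0
  have "restrict (\<lambda>_. 0) (carrier_vec n) \<in> (forms n d :: ('p mod_ring Matrix.vec \<Rightarrow> 'p mod_ring) set)"
    by (rule formsI) (simp add: fdiff_eq_0)
  then have "{s :: nat \<Rightarrow> 'p mod_ring Matrix.vec. \<not> (\<exists>f\<in>forms n d. \<forall>v\<in>s ` {..<0::nat}. f v \<noteq> 0)} = {}"
    by auto
  then show ?case by (simp only: measure_empty)
next
  case (Suc m)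
  define p where "p = real CARD('p)"
  have p: "p > 0" by (simp add: p_def)
  let ?V = "carrier_vec n :: 'p mod_ring Matrix.vec set"
  define U where "U = pmf_of_set ?V"
  have ne: "?V \<noteq> {}" by (metis emptyE zero_carrier_vec)
  define Q where "Q m = Pi_pmf {..<m} (0\<^sub>v n) (\<lambda>_. U)" for m :: nat
  define B where "B m = {s :: nat \<Rightarrow> 'p mod_ring Matrix.vec.
    \<not> (\<exists>f\<in>forms n d. \<forall>v\<in>s ` {..<m}. f v \<noteq> 0)}" for m :: nat
  \<comment> \<open>Subtraction is truncated. At \<open>n - Suc l = 0\<close> the bound on the
    number of draws would be \<open>(d - 1) choose d = 0\<close>; otherwise
    \<open>n = Suc (n - Suc l) + l\<close> holds exactly.\<close>
  have n': "n - Suc l > 0"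
  proof (rule ccontr)
    assume "\<not> ?thesis"
    with Suc.prems d show False by (simp add: binomial_eq_0)
  qed
  \<comment> \<open>The new point must come last, with the earlier ones fixed;
    \<open>Pi_pmf_insert'\<close> draws it first, so the two draws are commuted.\<close>
  have Q_Suc: "Q (Suc m) = bind_pmf (Q m) (\<lambda>s. map_pmf (\<lambda>v. s(m := v)) U)"
    unfolding Q_def lessThan_Suc
    by (subst Pi_pmf_insert') (auto simp: map_pmf_def bind_commute_pmf[of U])
  have "measure_pmf.prob (bind_pmf (Q m) (\<lambda>s. map_pmf (\<lambda>v. s(m := v)) U)) (B (Suc m))
      \<le> measure_pmf.prob (Q m) (B m) + 1 / p ^ l"
  proof (rule prob_bind_pmf_le)
    fix s assume s: "s \<in> set_pmf (Q m)" "s \<notin> B m"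
    define S where "S = s ` {..<m}"
    have S: "finite S" "S \<subseteq> ?V"
      using s(1) ne by (auto simp: Q_def S_def U_def set_Pi_pmf PiE_dflt_def)
    have "card S \<le> m" unfolding S_def using card_image_le[of "{..<m}" s] by simp
    then have "card (forced_zeros n d S) < CARD('p) ^ Suc (n - Suc l)"
      using Suc.prems by (intro card_forced_zeros[OF d(2) S]) simp
    then have "real (card (forced_zeros n d S)) \<le> p ^ Suc (n - Suc l)"
      unfolding p_def by (metis less_imp_le of_nat_le_iff of_nat_power)
    moreover have "n = Suc (n - Suc l) + l" using n' by simp
    then have "p ^ n = p ^ Suc (n - Suc l) * p ^ l" by (metis power_add)
    ultimately have small: "real (card (forced_zeros n d S)) / p ^ n \<le> 1 / p ^ l"
      using p by (simp add: field_simps)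
    obtain f where f: "f \<in> forms n d" "\<forall>v\<in>S. f v \<noteq> 0"
      using s(2) by (auto simp: B_def S_def)
    have sub: "?V \<inter> {v. s(m := v) \<in> B (Suc m)} \<subseteq> forced_zeros n d S"
    proof (rule ccontr)
      assume "\<not> ?thesis"
      then obtain v where v: "v \<in> ?V" "s(m := v) \<in> B (Suc m)" "v \<notin> forced_zeros n d S" by auto
      have eq: "(s(m := v)) ` {..<Suc m} = insert v S" by (auto simp: S_def lessThan_Suc)
      show False
        using ex_nonvanishing_form_insert[OF S(2) f v(1,3)] v(2)
        unfolding B_def mem_Collect_eq eq by blast
    qed
    have "measure_pmf.prob (map_pmf (\<lambda>v. s(m := v)) U) (B (Suc m))
        = card (?V \<inter> {v. s(m := v) \<in> B (Suc m)}) / card ?V"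
      using ne by (simp add: U_def measure_pmf_of_set vimage_def)
    also have "\<dots> \<le> card (forced_zeros n d S) / p ^ n"
      using card_mono[OF _ sub] finite_subset[of "forced_zeros n d S" ?V]
      by (simp add: card_carrier_vec p_def forced_zeros_def divide_right_mono)
    finally show "measure_pmf.prob (map_pmf (\<lambda>v. s(m := v)) U) (B (Suc m)) \<le> 1 / p ^ l"
      using small by simp
  qed (use p in simp)
  also have "\<dots> \<le> m / p ^ l + 1 / p ^ l"
    using Suc by (simp add: Q_def U_def B_def p_def)
  finally have "measure_pmf.prob (Q (Suc m)) (B (Suc m)) \<le> real (Suc m) / p ^ l"
    unfolding Q_Suc by (simp add: add_divide_distrib add.commute)
  then show ?case by (simp add: Q_def U_def B_def p_def)
qed

section \<open>From a nonvanishing form to a progression-free level set\<close>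

lemma ex_large_fibre:
  fixes f :: "'a \<Rightarrow> 'b::finite"
  assumes "finite V"
  shows "\<exists>c. card V \<le> CARD('b) * card {x \<in> V. f x = c}"
proof (rule ccontr)
  assume "\<not> ?thesis"
  then have *: "CARD('b) * card {x \<in> V. f x = c} < card V" for c by (simp add: not_le)
  have "card V = (\<Sum>c\<in>UNIV. card {x \<in> V. f x = c})"
    using sum.group[OF assms, of "UNIV :: 'b set" f "\<lambda>_. 1 :: nat"] by simp
  then have "CARD('b) * card V = (\<Sum>c\<in>UNIV. CARD('b) * card {x \<in> V. f x = c})"
    by (simp add: sum_distrib_left)
  also have "\<dots> < (\<Sum>c\<in>(UNIV :: 'b set). card V)"
    using * by (intro sum_strict_mono) auto
  finally show False by simp
qed

lemma ex_large_AP_free_set: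
  fixes f :: "'p::prime_card mod_ring Matrix.vec \<Rightarrow> 'p mod_ring"
  assumes f: "f \<in> forms n d" and d: "0 < d" "d < CARD('p)" and S: "\<forall>v\<in>S. f v \<noteq> 0"
  shows "\<exists>A \<subseteq> carrier_vec n. real (card A) \<ge> 1 / real CARD('p) * real CARD('p) ^ n
    \<and> \<not> contains_proper_AP n (Suc d) S A"
proof -
  obtain c where c: "card (carrier_vec n :: 'p mod_ring Matrix.vec set)
      \<le> CARD('p mod_ring) * card {x \<in> carrier_vec n. f x = c}"
    using ex_large_fibre[of "carrier_vec n" f] by auto
  define A where "A = {x \<in> carrier_vec n. f x = c}"
  have "real (CARD('p) ^ n) \<le> real (CARD('p) * card A)"
    using c by (intro of_nat_mono) (simp add: A_def card_carrier_vec)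
  then have "1 / real CARD('p) * real CARD('p) ^ n \<le> card A"
    by (simp add: field_simps)
  moreover have "\<not> contains_proper_AP n (Suc d) S A"
  proof
    assume "contains_proper_AP n (Suc d) S A"
    then obtain x y where xy: "x \<in> carrier_vec n" "y \<in> carrier_vec n" "y \<in> S"
      and AP: "set (arith_prog (Suc d) x y) \<subseteq> A"
      unfolding contains_proper_AP_def by blast
    \<comment> \<open>Since \<open>y \<in> S\<close>, the value \<open>f y\<close> is nonzero, so
      \<open>f\<close> cannot equal \<open>c\<close> at all \<open>d + 1\<close> terms.\<close>
    obtain i where i: "i \<le> d" "f (x + of_nat i \<cdot>\<^sub>v y) \<noteq> c"
      using forms_not_const_on_line[OF f d(2,1) xy(1,2)] S xy(3) by blast
    have "x + of_nat i \<cdot>\<^sub>v y \<in> set (arith_prog (Suc d) x y)"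
      using i(1) by (auto simp: arith_prog_def image_iff simp del: upt_Suc intro!: bexI[of _ i])
    with AP i(2) show False by (auto simp: A_def)
  qed
  moreover have "A \<subseteq> carrier_vec n" by (auto simp: A_def)
  ultimately show ?thesis by blast
qed

lemma prob_ex_large_AP_free_set:
  assumes d: "0 < d" "d < CARD('p::prime_card)"
    and m: "m \<le> ((n - Suc l) + d - 1) choose d"
  shows "measure_pmf.prob (random_set n m :: 'p mod_ring Matrix.vec set pmf)
    {S. \<exists>A \<subseteq> carrier_vec n. real (card A) \<ge> 1 / real CARD('p) * real CARD('p) ^ n
      \<and> \<not> contains_proper_AP n (Suc d) S A} \<ge> 1 - m / real CARD('p) ^ l"
proof -
  let ?Q = "Pi_pmf {..<m} (0\<^sub>v n) (\<lambda>_. pmf_of_set (carrier_vec n :: 'p mod_ring Matrix.vec set))"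
  define G where "G = {s :: nat \<Rightarrow> 'p mod_ring Matrix.vec. \<exists>f\<in>forms n d. \<forall>v\<in>s ` {..<m}. f v \<noteq> 0}"
  let ?E = "{S :: 'p mod_ring Matrix.vec set. \<exists>A \<subseteq> carrier_vec n.
    real (card A) \<ge> 1 / real CARD('p) * real CARD('p) ^ n \<and> \<not> contains_proper_AP n (Suc d) S A}"
  have "measure_pmf.prob ?Q (- G) \<le> m / real CARD('p) ^ l"
    using prob_no_nonvanishing_form[OF d m] by (simp add: G_def Compl_eq)
  then have "1 - m / real CARD('p) ^ l \<le> measure_pmf.prob ?Q G"
    using measure_pmf.prob_compl[of G ?Q] by (simp add: Compl_eq_Diff_UNIV)
  also have "\<dots> \<le> measure_pmf.prob ?Q ((\<lambda>s. s ` {..<m}) -` ?E)"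
  proof (intro measure_pmf.finite_measure_mono subsetI)
    fix s assume "s \<in> G"
    then obtain f where "f \<in> forms n d" "\<forall>v\<in>s ` {..<m}. f v \<noteq> 0" unfolding G_def by blast
    from ex_large_AP_free_set[OF this(1) d this(2)] show "s \<in> (\<lambda>s. s ` {..<m}) -` ?E" by simp
  qed simp
  also have "\<dots> = measure_pmf.prob (random_set n m) ?E"
    by (simp add: random_set_def)
  finally show ?thesis .
qed

section \<open>Binomial estimates and the choice of parameters\<close>

lemma choose_diff_le:
  "(n + Suc d - 1) choose Suc d \<le> (((n - r) + Suc d - 1) choose Suc d) + r * ((n + d - 1) choose d)"
proof (induction r)
  case (Suc r)
  show ?case
  proof (cases "n - r")
    case 0
    then show ?thesis using Suc by simp
  next
    case (Suc a)
    then have a: "n - Suc r = a" "Suc a \<le> n" by auto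
    \<comment> \<open>Pascal's rule: giving up one variable costs one binomial coefficient of lower
      degree.\<close>
    have "((n - r) + Suc d - 1) choose Suc d = ((a + Suc d - 1) choose Suc d) + ((a + d) choose d)"
      unfolding Suc by simp
    moreover have "(a + d) choose d \<le> (n + d - 1) choose d"
      using a by (intro binomial_right_mono) auto
    ultimately show ?thesis using Suc.IH a by simp
  qed
qed simp

text \<open>A crude bound from \<open>n + d - 1 \<le> d * n\<close>, used both for the size of
  \<open>m\<close> and for the cost of the variables given up.\<close>

lemma choose_le_power:
  assumes "1 \<le> n"
  shows "(n + d - 1) choose d \<le> (d * n) ^ d"
proof (cases d)
  case (Suc e)
  have "(n + d - 1) choose d \<le> (n + d - 1) ^ d"
    using assms by (intro binomial_le_pow) simp
  also have "\<dots> \<le> (d * n) ^ d"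
  proof (rule power_mono)
    obtain q where "n = Suc q" using assms by (cases n) auto
    then show "n + d - 1 \<le> d * n" using Suc by simp
  qed simp
  finally show ?thesis .
qed simp

theorem theorem1p5:
  fixes k p :: nat
  assumes "k \<ge> 3" and "prime p" and "p \<ge> k" and "CARD('p::prime_card) = p"
  shows "\<exists>C c :: real. c > 0 \<and>
    (\<exists>\<delta> :: nat \<Rightarrow> real. \<delta> \<longlonglongrightarrow> 0 \<and>
      (\<forall>n m :: nat.
        real m \<le> real ((n + k - 2) choose (k - 1))
                  - C * (log (real p) (real n))\<^sup>2 * real n ^ (k - 2) \<longrightarrow>
        measure_pmf.prob (random_set n m :: 'p mod_ring Matrix.vec set pmf)
          {S. \<exists>A \<subseteq> carrier_vec n. real (card A) \<ge> c * real p ^ n \<and>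
                \<not> contains_proper_AP n k S A}
          \<ge> 1 - \<delta> n))"
proof -
  define e d where "e = k - 2" and "d = Suc e"
  have k: "k = Suc d" "k - 2 = e" "k - 1 = d" and "0 < d" and dp: "d < CARD('p)"
    using assms by (auto simp: e_def d_def)
  have nk: "n + k - 2 = n + d - 1" for n using k(1) by simp
  have p: "p > 1" using assms(2) by (rule prime_gt_1_nat)
  \<comment> \<open>The factor \<open>d + 3\<close> comes from
    \<open>Suc l \<le> (d + 1) * L + 2 \<le> (d + 3) * L\<close>, and \<open>e ^ e\<close> from
    \<open>choose_le_power\<close> in degree \<open>e\<close>.\<close>
  define C where "C = real (d + 3) * real e ^ e"
  \<comment> \<open>For \<open>n < p\<close> the claim is made trivial; from \<open>n = p\<close>
    on, the logarithm is at least 1.\<close>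
  define \<delta> where "\<delta> n = (if n < p then 1 else real d ^ d / real n)" for n
  have "(\<lambda>n. real d ^ d / real n) \<longlonglongrightarrow> 0" by real_asymp
  then have \<delta>: "\<delta> \<longlonglongrightarrow> 0"
    by (rule Lim_transform_eventually)
       (use eventually_ge_at_top[of p] in eventually_elim, simp add: \<delta>_def)
  have main: "measure_pmf.prob (random_set n m :: 'p mod_ring Matrix.vec set pmf)
      {S. \<exists>A \<subseteq> carrier_vec n. real (card A) \<ge> 1 / real p * real p ^ n \<and>
        \<not> contains_proper_AP n k S A} \<ge> 1 - \<delta> n"
    if m: "real m \<le> real ((n + k - 2) choose (k - 1))
      - C * (log (real p) (real n))\<^sup>2 * real n ^ (k - 2)" for n m
  proof (cases "n < p")
    case True
    then show ?thesis by (simp add: \<delta>_def)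
  next
    case False
    then have n: "n \<ge> p" "n \<ge> 1" using p by auto
    define L where "L = log (real p) (real n)"
    have L: "L \<ge> 1" using n p by (simp add: L_def)
    \<comment> \<open>This makes \<open>p ^ l\<close> at least \<open>n ^ (d + 1)\<close>, which
      beats the bound \<open>(d * n) ^ d\<close> on \<open>m\<close> by a factor of order
      \<open>n\<close>.\<close>
    define l where "l = nat \<lceil>real (Suc d) * L\<rceil>"
    have l: "real (Suc d) * L \<le> real l" "real l \<le> real (Suc d) * L + 1"
      using L of_int_ceiling_le_add_one[of "real (Suc d) * L"] by (simp_all add: l_def)
    \<comment> \<open>The number \<open>Suc l\<close> of variables given up is linear in
      \<open>L\<close>; it is absorbed into the squared logarithm.\<close>
    have "L \<le> L\<^sup>2" using L by (simp add: power2_eq_square)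
    then have "real (d + 3) * L \<le> real (d + 3) * L\<^sup>2" by (intro mult_left_mono) auto
    moreover have "real (Suc l) \<le> real (d + 3) * L"
      using l(2) L by (simp add: algebra_simps)
    ultimately have r: "real (Suc l) \<le> real (d + 3) * L\<^sup>2" by linarith
    have "(n + d - 1) choose d \<le> (((n - Suc l) + d - 1) choose d) + Suc l * ((n + e - 1) choose e)"
      unfolding d_def by (rule choose_diff_le)
    also have "\<dots> \<le> (((n - Suc l) + d - 1) choose d) + Suc l * (e * n) ^ e"
      by (intro add_left_mono mult_left_mono choose_le_power n) simp
    finally have "real ((n + d - 1) choose d)
        \<le> real ((((n - Suc l) + d - 1) choose d) + Suc l * (e * n) ^ e)"
      by (rule of_nat_mono)
    also have "\<dots> = real (((n - Suc l) + d - 1) choose d) + real (Suc l) * (real e ^ e * real n ^ e)"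
      by (simp add: power_mult_distrib distrib_right)
    also have "real (Suc l) * (real e ^ e * real n ^ e) \<le> real (d + 3) * L\<^sup>2 * (real e ^ e * real n ^ e)"
      by (intro mult_right_mono r) simp
    also have "\<dots> = C * L\<^sup>2 * real n ^ e" by (simp add: C_def)
    finally have "real m \<le> real (((n - Suc l) + d - 1) choose d)"
      using m unfolding k(2,3) nk L_def by simp
    then have m': "m \<le> ((n - Suc l) + d - 1) choose d" by simp
    have "real m / real p ^ l \<le> \<delta> n"
    proof -
      have "C * L\<^sup>2 * real n ^ e \<ge> 0" by (simp add: C_def)
      then have "real m \<le> real ((n + d - 1) choose d)"
        using m unfolding k(2,3) nk L_def by simp
      also have "\<dots> \<le> real ((d * n) ^ d)" by (intro of_nat_mono choose_le_power n)
      finally have num: "real m \<le> real d ^ d * real n ^ d" by (simp add: power_mult_distrib)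
      have "real n ^ Suc d = (real p powr L) powr real (Suc d)"
        using n p by (simp add: L_def powr_realpow del: power_Suc of_nat_Suc)
      also have "\<dots> = real p powr (real (Suc d) * L)" by (simp add: powr_powr mult.commute)
      also have "\<dots> \<le> real p powr real l" using l(1) p by (intro powr_mono) auto
      also have "\<dots> = real p ^ l" using p by (simp add: powr_realpow)
      finally have den: "real n ^ Suc d \<le> real p ^ l" .
      have "real m / real p ^ l \<le> (real d ^ d * real n ^ d) / real n ^ Suc d"
        using n by (intro frac_le num den) auto
      also have "\<dots> = \<delta> n" using n by (simp add: \<delta>_def)
      finally show ?thesis .
    qed
    then show ?thesis
      using prob_ex_large_AP_free_set[OF \<open>0 < d\<close> dp m'] unfolding assms(4) k(1) by linarith
  qed
  show ?thesis
    using p \<delta> main by (intro exI[of _ C] exI[of _ "1 / real p"] conjI exI[of _ \<delta>]) auto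
qed

end
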